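(* Let $Q$ be a faithful quandle and $\alpha$ a congruence of $Q$. Then (1) $\alpha$ is abelian if and only if $\mathrm{Dis}_\alpha$ is abelian; (2) $\alpha$ is central if and only if $\mathrm{Dis}_\alpha$ is central in $\mathrm{Dis}(Q)$.
   Context: A left quasigroup is a nonempty set $Q$ with two binary operations $*,\backslash$ satisfying $x\backslash(x*y)=y=x*(x\backslash y)$; write $L_a(b)=a*b$, a permutation of $Q$. A quandle is a left quasigroup satisfying $x*(y*z)=(x*y)*(x*z)$ and $x*x=x$. It is faithful if $L_a=L_b$ implies $a=b$. $\mathrm{Dis}(Q)=\langle L_aL_b^{-1}:a,b\in Q\rangle$, and for a congruence $\alpha$ (an equivalence compatible with $*$ and $\backslash$), $\mathrm{Dis}_\alpha=\langle L_aL_b^{-1}: a\,\alpha\,b\rangle$. "Central in $\mathrm{Dis}(Q)$" means contained in the center of $\mathrm{Dis}(Q)$. For congruences $\alpha,\beta,\delta$ of an algebraic structure $A$, $C(\alpha,\beta;\delta)$ means: for every $n\ge0$, every $(n+1)$-ary term operation $t$, every $a\,\alpha\,b$ and all $u_i\,\beta\,v_i$ ($i=1,\dots,n$), $t(a,u_1,\dots,u_n)\,\delta\,t(a,v_1,\dots,v_n)$ implies $t(b,u_1,\dots,u_n)\,\delta\,t(b,v_1,\dots,v_n)$. With $0_A$ the equality relation and $1_A=A\times A$, a congruence $\alpha$ is abelian if $C(\alpha,\alpha;0_A)$ and central if $C(\alpha,1_A;0_A)$. For quandles, terms use both $*$ and $\backslash$. *)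

theory Defs
  imports "HOL-Algebra.Bij" "HOL-Algebra.Generated_Groups"
begin

record 'a left_quasigroup = "'a partial_object" +
  qop :: "'a \<Rightarrow> 'a \<Rightarrow> 'a" (infixl \<open>\<star>\<index>\<close> 70)
  ldiv :: "'a \<Rightarrow> 'a \<Rightarrow> 'a" (infixl \<open>\<setminus>\<index>\<close> 70)

locale left_quasigroup =
  fixes Q (structure)
  assumes nonempty: "carrier Q \<noteq> {}"
    and qop_closed: "\<lbrakk>x \<in> carrier Q; y \<in> carrier Q\<rbrakk> \<Longrightarrow> x \<star> y \<in> carrier Q"
    and ldiv_closed: "\<lbrakk>x \<in> carrier Q; y \<in> carrier Q\<rbrakk> \<Longrightarrow> x \<setminus> y \<in> carrier Q"
    and ldiv_qop: "\<lbrakk>x \<in> carrier Q; y \<in> carrier Q\<rbrakk> \<Longrightarrow> x \<setminus> (x \<star> y) = y"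
    and qop_ldiv: "\<lbrakk>x \<in> carrier Q; y \<in> carrier Q\<rbrakk> \<Longrightarrow> x \<star> (x \<setminus> y) = y"

locale quandle = left_quasigroup +
  assumes self_distrib:
      "\<lbrakk>x \<in> carrier Q; y \<in> carrier Q; z \<in> carrier Q\<rbrakk> \<Longrightarrow> x \<star> (y \<star> z) = (x \<star> y) \<star> (x \<star> z)"
    and idem: "x \<in> carrier Q \<Longrightarrow> x \<star> x = x"

definition left_translation :: "('a, 'b) left_quasigroup_scheme \<Rightarrow> 'a \<Rightarrow> 'a \<Rightarrow> 'a" where
  "left_translation Q a = (\<lambda>x \<in> carrier Q. a \<star>\<^bsub>Q\<^esub> x)"

lemma (in left_quasigroup) left_translation_in_BijGroup:
  assumes "a \<in> carrier Q"
  shows "left_translation Q a \<in> carrier (BijGroup (carrier Q))"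
proof -
  have "bij_betw (left_translation Q a) (carrier Q) (carrier Q)"
    by (rule bij_betw_byWitness[where f' = "\<lambda>x. a \<setminus> x"])
      (use assms in \<open>auto simp: left_translation_def qop_closed ldiv_closed ldiv_qop qop_ldiv\<close>)
  then show ?thesis
    by (simp add: BijGroup_def Bij_def left_translation_def)
qed

locale faithful_quandle = quandle +
  assumes faithful: "\<lbrakk>a \<in> carrier Q; b \<in> carrier Q; left_translation Q a = left_translation Q b\<rbrakk>
    \<Longrightarrow> a = b"

definition congruence :: "('a, 'b) left_quasigroup_scheme \<Rightarrow> ('a \<times> 'a) set \<Rightarrow> bool" where
  "congruence Q \<alpha> \<longleftrightarrow> equiv (carrier Q) \<alpha> \<and>
    (\<forall>(a, b) \<in> \<alpha>. \<forall>(c, d) \<in> \<alpha>. (a \<star>\<^bsub>Q\<^esub> c, b \<star>\<^bsub>Q\<^esub> d) \<in> \<alpha> \<and> (a \<setminus>\<^bsub>Q\<^esub> c, b \<setminus>\<^bsub>Q\<^esub> d) \<in> \<alpha>)"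


definition Dis_cong :: "('a, 'b) left_quasigroup_scheme \<Rightarrow> ('a \<times> 'a) set \<Rightarrow> ('a \<Rightarrow> 'a) set" where
  "Dis_cong Q \<alpha> = generate (BijGroup (carrier Q))
     {left_translation Q a \<otimes>\<^bsub>BijGroup (carrier Q)\<^esub> inv\<^bsub>BijGroup (carrier Q)\<^esub> (left_translation Q b)
       | a b. (a, b) \<in> \<alpha>}"

definition Dis :: "('a, 'b) left_quasigroup_scheme \<Rightarrow> ('a \<Rightarrow> 'a) set" where
  "Dis Q = Dis_cong Q (carrier Q \<times> carrier Q)"

definition group_center :: "('a, 'b) monoid_scheme \<Rightarrow> 'a set" where
  "group_center G = {z \<in> carrier G. \<forall>g \<in> carrier G. z \<otimes>\<^bsub>G\<^esub> g = g \<otimes>\<^bsub>G\<^esub> z}"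


datatype lq_term = Var nat | Op lq_term lq_term | Ldiv lq_term lq_term

primrec term_vars :: "lq_term \<Rightarrow> nat set" where
  "term_vars (Var i) = {i}"
| "term_vars (Op s t) = term_vars s \<union> term_vars t"
| "term_vars (Ldiv s t) = term_vars s \<union> term_vars t"

primrec eval_term :: "('a, 'b) left_quasigroup_scheme \<Rightarrow> (nat \<Rightarrow> 'a) \<Rightarrow> lq_term \<Rightarrow> 'a" where
  "eval_term Q e (Var i) = e i"
| "eval_term Q e (Op s t) = eval_term Q e s \<star>\<^bsub>Q\<^esub> eval_term Q e t"
| "eval_term Q e (Ldiv s t) = eval_term Q e s \<setminus>\<^bsub>Q\<^esub> eval_term Q e t"

text \<open>The term condition \<open>C(\<alpha>, \<beta>; \<delta>)\<close>. An \<open>(n + 1)\<close>-ary term has its variables among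
  \<open>0, \<dots>, n\<close>; variable \<open>0\<close> is the distinguished argument, and the values of \<open>u\<close> and \<open>v\<close> outside
  \<open>{1..n}\<close> play no role.\<close>

definition centralizes ::
    "('a, 'b) left_quasigroup_scheme \<Rightarrow> ('a \<times> 'a) set \<Rightarrow> ('a \<times> 'a) set \<Rightarrow> ('a \<times> 'a) set \<Rightarrow> bool" where
  "centralizes Q \<alpha> \<beta> \<delta> \<longleftrightarrow>
    (\<forall>n t a b u v.
      term_vars t \<subseteq> {..n} \<longrightarrow> (a, b) \<in> \<alpha> \<longrightarrow> (\<forall>i \<in> {1..n}. (u i, v i) \<in> \<beta>) \<longrightarrow>
      (eval_term Q (u(0 := a)) t, eval_term Q (v(0 := a)) t) \<in> \<delta> \<longrightarrow>
      (eval_term Q (u(0 := b)) t, eval_term Q (v(0 := b)) t) \<in> \<delta>)"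

definition abelian_cong :: "('a, 'b) left_quasigroup_scheme \<Rightarrow> ('a \<times> 'a) set \<Rightarrow> bool" where
  "abelian_cong Q \<alpha> \<longleftrightarrow> centralizes Q \<alpha> \<alpha> (Id_on (carrier Q))"

definition central_cong :: "('a, 'b) left_quasigroup_scheme \<Rightarrow> ('a \<times> 'a) set \<Rightarrow> bool" where
  "central_cong Q \<alpha> \<longleftrightarrow> centralizes Q \<alpha> (carrier Q \<times> carrier Q) (Id_on (carrier Q))"

end

theory Submission
  imports Defs
begin

text \<open>
  Both equivalences are instances of one statement about two congruences \<open>\<alpha>\<close>, \<open>\<beta>\<close> of a faithful
  quandle: \<open>C(\<alpha>, \<beta>; 0)\<close> holds iff every element of \<open>Dis\<^sub>\<alpha>\<close> commutes with every element of
  \<open>Dis\<^sub>\<beta>\<close>. Part (1) is the case \<open>\<beta> = \<alpha>\<close>, and part (2) the case \<open>\<beta> = 1\<close>.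

  From the term condition to commutation: the generators \<open>L\<^sub>a L\<^sub>b\<inverse>\<close> and \<open>g = L\<^sub>c L\<^sub>d\<inverse>\<close> commute iff the
  conjugates of \<open>g\<close> by \<open>L\<^sub>a\<inverse>\<close> and by \<open>L\<^sub>b\<inverse>\<close> agree at every point \<open>x\<close>. The value at \<open>x\<close> of the
  conjugate by \<open>L\<^sub>a\<inverse>\<close> is the term \<open>a \<setminus> (c * (d \<setminus> (a * x)))\<close>, and for \<open>c = d\<close> this term collapses to \<open>x\<close>
  whatever \<open>a\<close> is. So the term condition compares the parameters \<open>(c, d, x)\<close> with \<open>(d, d, y)\<close>,
  where \<open>y\<close> is the value at \<open>a\<close>, and transports the equality from \<open>a\<close> to \<open>b\<close>.

  From commutation to the term condition: let \<open>a \<alpha> b\<close> and \<open>u \<beta> v\<close> be given. Since left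
  translations are automorphisms, the left translation by the value of a term is built from the
  left translations by the values of its subterms by conjugation. Commutation therefore gives, by
  induction on \<open>t\<close>, that the displacement from \<open>t(a, u)\<close> to \<open>t(b, u)\<close>, namely
  \<open>L\<^bsub>t(b,u)\<^esub> L\<^bsub>t(a,u)\<^esub>\<inverse>\<close>, is the same as the one from \<open>t(a, v)\<close> to \<open>t(b, v)\<close>. If moreover
  \<open>t(a, u) = t(a, v)\<close>, then \<open>L\<^bsub>t(b,u)\<^esub> = L\<^bsub>t(b,v)\<^esub>\<close>, and faithfulness turns this into
  \<open>t(b, u) = t(b, v)\<close>.
\<close>

section \<open>Conjugation and commuting elements in a group\<close>

context group
begin

lemma inv_mult_cancel_left:
  assumes "x \<in> carrier G" "y \<in> carrier G"
  shows "inv x \<otimes> (x \<otimes> y) = y" and "x \<otimes> (inv x \<otimes> y) = y"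
  using assms by (simp_all flip: m_assoc)

lemma inv_commutes:
  assumes "x \<in> carrier G" "y \<in> carrier G" "x \<otimes> y = y \<otimes> x"
  shows "inv x \<otimes> y = y \<otimes> inv x"
proof -
  have "inv x \<otimes> y = inv x \<otimes> (y \<otimes> x) \<otimes> inv x"
    using assms(1,2) by (simp add: m_assoc)
  also have "\<dots> = y \<otimes> inv x"
    using assms(1,2) by (simp add: assms(3)[symmetric] m_assoc inv_mult_cancel_left)
  finally show ?thesis .
qed

lemma generate_commutes_with_element:
  assumes "A \<subseteq> carrier G" "h \<in> carrier G" "\<And>a. a \<in> A \<Longrightarrow> a \<otimes> h = h \<otimes> a"
    and "g \<in> generate G A"
  shows "g \<otimes> h = h \<otimes> g"
  using assms(4)
proof (induction rule: generate.induct)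
  case (eng g1 g2)
  have "g1 \<in> carrier G" "g2 \<in> carrier G"
    using eng.hyps assms(1) by (auto intro: generate_in_carrier)
  then show ?case
    using eng.IH assms(2) by (metis m_assoc)
qed (use assms in \<open>auto intro!: inv_commutes\<close>)

lemma generate_commutes:
  assumes "A \<subseteq> carrier G" "B \<subseteq> carrier G"
    and "\<And>a b. \<lbrakk>a \<in> A; b \<in> B\<rbrakk> \<Longrightarrow> a \<otimes> b = b \<otimes> a"
    and "g \<in> generate G A" "h \<in> generate G B"
  shows "g \<otimes> h = h \<otimes> g"
proof (rule generate_commutes_with_element[OF assms(1) _ _ assms(4)])
  show "h \<in> carrier G"
    using assms(2,5) by (rule generate_in_carrier)
  fix a assume "a \<in> A"
  then show "a \<otimes> h = h \<otimes> a"
    using generate_commutes_with_element[OF assms(2) _ _ assms(5), of a] assms(1,3) by fastforce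
qed

lemma conjugate_eqI:
  assumes "x \<in> carrier G" "y \<in> carrier G" "k \<in> carrier G"
    and "k \<otimes> (inv x \<otimes> y) = (inv x \<otimes> y) \<otimes> k"
  shows "x \<otimes> k \<otimes> inv x = y \<otimes> k \<otimes> inv y"
proof -
  have "x \<otimes> k \<otimes> inv x = x \<otimes> (k \<otimes> (inv x \<otimes> y)) \<otimes> inv y"
    using assms(1-3) by (simp add: m_assoc)
  also have "\<dots> = y \<otimes> k \<otimes> inv y"
    using assms(1-3) by (simp add: assms(4) m_assoc inv_mult_cancel_left)
  finally show ?thesis .
qed

text \<open>
  Here \<open>d\<close> and \<open>e\<close> are the displacements of two factors, from \<open>x\<close> to \<open>d \<otimes> x\<close> and from \<open>z\<close> to
  \<open>e \<otimes> z\<close>. The displacement of a conjugate involves \<open>x\<close> and \<open>z\<close> only through conjugates of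
  \<open>d\<close> and \<open>e\<close>; this is why the displacement survives a change of \<open>x\<close> and \<open>z\<close> that leaves
  these conjugates alone.
\<close>

lemma displacement_of_conjugate:
  assumes "x \<in> carrier G" "z \<in> carrier G" "d \<in> carrier G" "e \<in> carrier G"
  shows "(d \<otimes> x) \<otimes> (e \<otimes> z) \<otimes> inv (d \<otimes> x) \<otimes> inv (x \<otimes> z \<otimes> inv x) =
      d \<otimes> (x \<otimes> e \<otimes> inv x) \<otimes> ((x \<otimes> z \<otimes> inv x) \<otimes> inv d \<otimes> inv (x \<otimes> z \<otimes> inv x))"
    and "inv (d \<otimes> x) \<otimes> (e \<otimes> z) \<otimes> (d \<otimes> x) \<otimes> inv (inv x \<otimes> z \<otimes> x) =
      inv x \<otimes> (inv d \<otimes> e \<otimes> (z \<otimes> d \<otimes> inv z)) \<otimes> x"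
  using assms by (simp_all add: m_assoc inv_mult_group inv_mult_cancel_left)

end

section \<open>Left translations and displacements\<close>

lemma congruence_total:
  assumes "left_quasigroup Q"
  shows "congruence Q (carrier Q \<times> carrier Q)"
  using assms unfolding congruence_def
  by (auto simp: left_quasigroup.qop_closed left_quasigroup.ldiv_closed
      intro!: equivI refl_onI symI transI)

context quandle
begin

abbreviation Perm where "Perm \<equiv> BijGroup (carrier Q)"
abbreviation L where "L \<equiv> left_translation Q"
abbreviation displacement where "displacement a b \<equiv> L a \<otimes>\<^bsub>Perm\<^esub> inv\<^bsub>Perm\<^esub> L b"

sublocale Perm: group Perm
  by (rule group_BijGroup)

lemma L_closed: "a \<in> carrier Q \<Longrightarrow> L a \<in> carrier Perm"
  by (rule left_translation_in_BijGroup)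

lemma L_apply: "x \<in> carrier Q \<Longrightarrow> L a x = a \<star> x"
  by (simp add: left_translation_def)

lemma Perm_mult_apply:
  "\<lbrakk>f \<in> carrier Perm; g \<in> carrier Perm; x \<in> carrier Q\<rbrakk> \<Longrightarrow> (f \<otimes>\<^bsub>Perm\<^esub> g) x = f (g x)"
  by (simp add: BijGroup_def compose_def)

lemma Perm_eqI:
  assumes "f \<in> carrier Perm" "g \<in> carrier Perm" "\<And>x. x \<in> carrier Q \<Longrightarrow> f x = g x"
  shows "f = g"
  using assms by (auto simp: BijGroup_def Bij_def intro: extensionalityI)

lemma inv_L_apply:
  assumes "a \<in> carrier Q" "x \<in> carrier Q"
  shows "(inv\<^bsub>Perm\<^esub> L a) x = a \<setminus> x"
proof -
  have "(inv\<^bsub>Perm\<^esub> L a) x = (inv\<^bsub>Perm\<^esub> L a) (L a (a \<setminus> x))"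
    using assms by (simp add: L_apply ldiv_closed qop_ldiv)
  also have "\<dots> = (inv\<^bsub>Perm\<^esub> L a \<otimes>\<^bsub>Perm\<^esub> L a) (a \<setminus> x)"
    using assms by (intro Perm_mult_apply[symmetric] Perm.inv_closed L_closed ldiv_closed)
  also have "\<dots> = a \<setminus> x"
    using assms by (simp add: L_closed ldiv_closed) (simp add: BijGroup_def ldiv_closed)
  finally show ?thesis .
qed

text \<open>Self-distributivity says that the left translation by \<open>x\<close> is an automorphism; in the group of
  permutations, it therefore conjugates translations to translations.\<close>

lemma L_qop:
  assumes "x \<in> carrier Q" "y \<in> carrier Q"
  shows "L (x \<star> y) = L x \<otimes>\<^bsub>Perm\<^esub> L y \<otimes>\<^bsub>Perm\<^esub> inv\<^bsub>Perm\<^esub> L x"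
proof -
  have "L (x \<star> y) \<otimes>\<^bsub>Perm\<^esub> L x = L x \<otimes>\<^bsub>Perm\<^esub> L y"
    by (rule Perm_eqI)
      (use assms in \<open>simp_all add: L_closed qop_closed Perm_mult_apply L_apply flip: self_distrib\<close>)
  moreover have "L (x \<star> y) = L (x \<star> y) \<otimes>\<^bsub>Perm\<^esub> L x \<otimes>\<^bsub>Perm\<^esub> inv\<^bsub>Perm\<^esub> L x"
    using assms by (simp add: L_closed qop_closed Perm.m_assoc)
  ultimately show ?thesis
    by simp
qed

lemma L_ldiv:
  assumes "x \<in> carrier Q" "y \<in> carrier Q"
  shows "L (x \<setminus> y) = inv\<^bsub>Perm\<^esub> L x \<otimes>\<^bsub>Perm\<^esub> L y \<otimes>\<^bsub>Perm\<^esub> L x"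
proof -
  have "L y = L x \<otimes>\<^bsub>Perm\<^esub> L (x \<setminus> y) \<otimes>\<^bsub>Perm\<^esub> inv\<^bsub>Perm\<^esub> L x"
    using L_qop[of x "x \<setminus> y"] assms by (simp add: ldiv_closed qop_ldiv)
  then show ?thesis
    using assms
    by (simp add: L_closed ldiv_closed Perm.m_assoc Perm.inv_mult_cancel_left)
qed

lemma ldiv_idem: "x \<in> carrier Q \<Longrightarrow> x \<setminus> x = x"
  using ldiv_qop[of x x] by (simp add: idem)

lemma displacement_closed:
  "\<lbrakk>a \<in> carrier Q; b \<in> carrier Q\<rbrakk> \<Longrightarrow> displacement a b \<in> carrier Perm"
  by (simp add: L_closed)

lemma L_eq_displacement_mult:
  "\<lbrakk>a \<in> carrier Q; b \<in> carrier Q\<rbrakk> \<Longrightarrow> L a = displacement a b \<otimes>\<^bsub>Perm\<^esub> L b"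
  by (simp add: L_closed Perm.m_assoc)

lemma conjugate_displacement:
  assumes "z \<in> carrier Q" "a \<in> carrier Q" "b \<in> carrier Q"
  shows "L z \<otimes>\<^bsub>Perm\<^esub> displacement a b \<otimes>\<^bsub>Perm\<^esub> inv\<^bsub>Perm\<^esub> L z = displacement (z \<star> a) (z \<star> b)"
  using assms by (simp add: L_qop L_closed Perm.m_assoc Perm.inv_mult_group Perm.inv_mult_cancel_left)

lemma congruence_carrier:
  assumes "congruence Q \<alpha>" "(a, b) \<in> \<alpha>"
  shows "a \<in> carrier Q" "b \<in> carrier Q"
  using assms unfolding congruence_def by (auto dest: equiv_type)

lemma congruence_refl: "\<lbrakk>congruence Q \<alpha>; a \<in> carrier Q\<rbrakk> \<Longrightarrow> (a, a) \<in> \<alpha>"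
  unfolding congruence_def by (auto dest: equiv_class_self)

lemma congruence_sym: "\<lbrakk>congruence Q \<alpha>; (a, b) \<in> \<alpha>\<rbrakk> \<Longrightarrow> (b, a) \<in> \<alpha>"
  unfolding congruence_def equiv_def by (auto dest: symD)

lemma congruence_compat:
  assumes "congruence Q \<alpha>" "(a, b) \<in> \<alpha>" "(c, d) \<in> \<alpha>"
  shows "(a \<star> c, b \<star> d) \<in> \<alpha>" "(a \<setminus> c, b \<setminus> d) \<in> \<alpha>"
  using assms unfolding congruence_def by blast+

lemma displacement_in_Dis_cong: "(a, b) \<in> \<alpha> \<Longrightarrow> displacement a b \<in> Dis_cong Q \<alpha>"
  unfolding Dis_cong_def by (auto intro: generate.incl)

text \<open>Conjugating the displacement \<open>L\<^sub>b L\<^sub>a\<inverse>\<close> by \<open>L\<^sub>b\<inverse>\<close> gives \<open>L\<^sub>a\<inverse> L\<^sub>b\<close>. The conjugate is again a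
  displacement, now of the related pair \<open>(b \<setminus> b, b \<setminus> a)\<close>, whose first entry is \<open>b\<close>. Conjugation by
  the translations by \<open>\<alpha>\<close>-related elements differs by such permutations, so both conjugations have the
  same effect on a permutation commuting with \<open>Dis\<^sub>\<alpha>\<close>.\<close>

lemma inverse_displacement_in_Dis_cong:
  assumes "congruence Q \<alpha>" "(a, b) \<in> \<alpha>"
  shows "inv\<^bsub>Perm\<^esub> L a \<otimes>\<^bsub>Perm\<^esub> L b \<in> Dis_cong Q \<alpha>"
proof -
  have ab: "a \<in> carrier Q" "b \<in> carrier Q"
    using congruence_carrier assms by auto
  have "displacement (b \<setminus> b) (b \<setminus> a) = inv\<^bsub>Perm\<^esub> L a \<otimes>\<^bsub>Perm\<^esub> L b"
  proof -
    have "displacement (b \<setminus> b) (b \<setminus> a) = L b \<otimes>\<^bsub>Perm\<^esub> (inv\<^bsub>Perm\<^esub> L b \<otimes>\<^bsub>Perm\<^esub> (inv\<^bsub>Perm\<^esub> L a \<otimes>\<^bsub>Perm\<^esub> L b))"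
      using ab by (simp add: ldiv_idem L_ldiv[of b a] L_closed Perm.m_assoc Perm.inv_mult_group)
    then show ?thesis
      using ab by (simp add: L_closed Perm.inv_mult_cancel_left)
  qed
  moreover have "(b \<setminus> b, b \<setminus> a) \<in> \<alpha>"
    using assms ab by (intro congruence_compat) (auto intro: congruence_refl congruence_sym)
  ultimately show ?thesis
    using displacement_in_Dis_cong by metis
qed

lemma subgroup_Dis_cong:
  assumes "congruence Q \<alpha>"
  shows "subgroup (Dis_cong Q \<alpha>) Perm"
  unfolding Dis_cong_def
  by (rule Perm.generate_is_subgroup)
    (auto intro!: displacement_closed dest: congruence_carrier[OF assms])

lemma Dis_cong_commute_iff:
  assumes "congruence Q \<alpha>" "congruence Q \<beta>"
  shows "(\<forall>g \<in> Dis_cong Q \<alpha>. \<forall>h \<in> Dis_cong Q \<beta>. g \<otimes>\<^bsub>Perm\<^esub> h = h \<otimes>\<^bsub>Perm\<^esub> g) \<longleftrightarrow>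
    (\<forall>(a, b) \<in> \<alpha>. \<forall>(c, d) \<in> \<beta>. displacement a b \<otimes>\<^bsub>Perm\<^esub> displacement c d =
      displacement c d \<otimes>\<^bsub>Perm\<^esub> displacement a b)" (is "?l \<longleftrightarrow> ?r")
proof
  show ?r if ?l
    using that by (auto intro: displacement_in_Dis_cong)
  have gens: "{displacement a b | a b. (a, b) \<in> \<gamma>} \<subseteq> carrier Perm" if "congruence Q \<gamma>" for \<gamma>
    using displacement_closed congruence_carrier[OF that] by blast
  show ?l if r: ?r
    unfolding Dis_cong_def
    by (intro ballI, erule (1) Perm.generate_commutes[OF gens[OF assms(1)] gens[OF assms(2)], rotated])
      (use r in blast)
qed

section \<open>The term condition forces displacement groups to commute\<close>

lemma centralizes_imp_displacements_commute:
  assumes cong: "congruence Q \<alpha>" "congruence Q \<beta>"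
    and C: "centralizes Q \<alpha> \<beta> (Id_on (carrier Q))"
    and ab: "(a, b) \<in> \<alpha>" and cd: "(c, d) \<in> \<beta>"
  shows "displacement a b \<otimes>\<^bsub>Perm\<^esub> displacement c d = displacement c d \<otimes>\<^bsub>Perm\<^esub> displacement a b"
proof -
  define g where "g = displacement c d"
  have car: "a \<in> carrier Q" "b \<in> carrier Q" "c \<in> carrier Q" "d \<in> carrier Q"
    using congruence_carrier cong ab cd by auto
  have g: "g \<in> carrier Perm"
    unfolding g_def by (simp add: car displacement_closed)
  have agree: "a \<setminus> (c \<star> (d \<setminus> (a \<star> x))) = b \<setminus> (c \<star> (d \<setminus> (b \<star> x)))"
    if x: "x \<in> carrier Q" for x
  proof -
    \<comment> \<open>With parameters \<open>(d, d, y)\<close> the term \<open>t\<close> has the value \<open>y\<close> at every first argument; \<open>y\<close> is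
      chosen as the value of \<open>t\<close> at \<open>a\<close> with parameters \<open>(c, d, x)\<close>.\<close>
    define y where "y = a \<setminus> (c \<star> (d \<setminus> (a \<star> x)))"
    define t where "t = Ldiv (Var 0) (Op (Var 1) (Ldiv (Var 2) (Op (Var 0) (Var 3))))"
    define u where "u = (\<lambda>i::nat. if i = 1 then c else if i = 2 then d else x)"
    define v where "v = (\<lambda>i::nat. if i = 1 then d else if i = 2 then d else y)"
    have y: "y \<in> carrier Q"
      unfolding y_def using car x by (simp add: qop_closed ldiv_closed)
    have "(c \<star> (d \<setminus> (a \<star> x)), d \<star> (d \<setminus> (a \<star> x))) \<in> \<beta>"
      using car x cong cd
      by (intro congruence_compat congruence_refl) (auto simp: qop_closed ldiv_closed)
    then have "(c \<star> (d \<setminus> (a \<star> x)), a \<star> x) \<in> \<beta>"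
      using car x by (simp add: qop_closed qop_ldiv)
    then have "(a \<setminus> (c \<star> (d \<setminus> (a \<star> x))), a \<setminus> (a \<star> x)) \<in> \<beta>"
      by (rule congruence_compat(2)[OF cong(2) congruence_refl[OF cong(2) car(1)]])
    then have "(x, y) \<in> \<beta>"
      using car x cong(2) by (auto simp: y_def ldiv_qop intro: congruence_sym)
    then have params: "(u i, v i) \<in> \<beta>" if "i \<in> {1..3}" for i
      using cd congruence_refl[OF cong(2) car(4)] by (auto simp: u_def v_def)
    have vars: "term_vars t \<subseteq> {..3}"
      by (auto simp: t_def)
    have "(eval_term Q (u(0 := a)) t, eval_term Q (v(0 := a)) t) \<in> Id_on (carrier Q)"
      using car y by (auto simp: t_def u_def v_def qop_closed ldiv_closed qop_ldiv ldiv_qop y_def[symmetric])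
    then have "(eval_term Q (u(0 := b)) t, eval_term Q (v(0 := b)) t) \<in> Id_on (carrier Q)"
      by (rule C[unfolded centralizes_def, rule_format, OF vars ab params, rotated])
    then have "b \<setminus> (c \<star> (d \<setminus> (b \<star> x))) = y"
      using car y by (auto simp: t_def u_def v_def qop_closed ldiv_closed qop_ldiv ldiv_qop)
    then show ?thesis
      by (simp add: y_def)
  qed
  have conj: "inv\<^bsub>Perm\<^esub> L a \<otimes>\<^bsub>Perm\<^esub> g \<otimes>\<^bsub>Perm\<^esub> L a = inv\<^bsub>Perm\<^esub> L b \<otimes>\<^bsub>Perm\<^esub> g \<otimes>\<^bsub>Perm\<^esub> L b"
  proof (rule Perm_eqI)
    fix x assume "x \<in> carrier Q"
    then show "(inv\<^bsub>Perm\<^esub> L a \<otimes>\<^bsub>Perm\<^esub> g \<otimes>\<^bsub>Perm\<^esub> L a) x = (inv\<^bsub>Perm\<^esub> L b \<otimes>\<^bsub>Perm\<^esub> g \<otimes>\<^bsub>Perm\<^esub> L b) x"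
      using car agree[of x]
      by (simp add: g_def Perm_mult_apply L_closed L_apply inv_L_apply qop_closed ldiv_closed)
  qed (use car g in \<open>simp_all add: L_closed\<close>)
  have "displacement a b \<otimes>\<^bsub>Perm\<^esub> g = L a \<otimes>\<^bsub>Perm\<^esub> (inv\<^bsub>Perm\<^esub> L b \<otimes>\<^bsub>Perm\<^esub> g \<otimes>\<^bsub>Perm\<^esub> L b) \<otimes>\<^bsub>Perm\<^esub> inv\<^bsub>Perm\<^esub> L b"
    using car g by (simp add: L_closed Perm.m_assoc)
  also have "\<dots> = L a \<otimes>\<^bsub>Perm\<^esub> (inv\<^bsub>Perm\<^esub> L a \<otimes>\<^bsub>Perm\<^esub> g \<otimes>\<^bsub>Perm\<^esub> L a) \<otimes>\<^bsub>Perm\<^esub> inv\<^bsub>Perm\<^esub> L b"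
    by (simp only: conj)
  also have "\<dots> = g \<otimes>\<^bsub>Perm\<^esub> displacement a b"
    using car g by (simp add: L_closed Perm.m_assoc Perm.inv_mult_cancel_left)
  finally show ?thesis
    by (simp add: g_def)
qed

section \<open>Commuting displacement groups force the term condition\<close>

lemma eval_term_congruent:
  assumes "congruence Q \<alpha>" "\<And>i. i \<in> term_vars t \<Longrightarrow> (e i, f i) \<in> \<alpha>"
  shows "(eval_term Q e t, eval_term Q f t) \<in> \<alpha>"
  using assms(2) by (induction t) (auto intro: congruence_compat[OF assms(1)])

text \<open>
  The four elements \<open>x, y, x', y'\<close> form a square with two sides in \<open>\<alpha>\<close>, joined along \<open>\<beta>\<close>; the
  squares whose two \<open>\<alpha>\<close>-sides have equal displacement are closed under both operations. The reason
  is that the displacement of a compound square is a product of displacements along \<open>\<alpha>\<close> conjugated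
  by translations, and moving the conjugating translation along \<open>\<beta>\<close> has no effect on an element of
  \<open>Dis\<^sub>\<alpha>\<close>.
\<close>

lemma displacement_square:
  assumes cong: "congruence Q \<alpha>" "congruence Q \<beta>"
    and comm: "\<forall>g \<in> Dis_cong Q \<alpha>. \<forall>h \<in> Dis_cong Q \<beta>. g \<otimes>\<^bsub>Perm\<^esub> h = h \<otimes>\<^bsub>Perm\<^esub> g"
    and xy: "(x, y) \<in> \<alpha>" "(x', y') \<in> \<alpha>" "(x, x') \<in> \<beta>" "displacement y x = displacement y' x'"
    and zw: "(z, w) \<in> \<alpha>" "(z', w') \<in> \<alpha>" "(z, z') \<in> \<beta>" "displacement w z = displacement w' z'"
  shows "displacement (y \<star> w) (x \<star> z) = displacement (y' \<star> w') (x' \<star> z')"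
    and "displacement (y \<setminus> w) (x \<setminus> z) = displacement (y' \<setminus> w') (x' \<setminus> z')"
proof -
  define D where "D = displacement y x"
  define E where "E = displacement w z"
  have car: "x \<in> carrier Q" "y \<in> carrier Q" "z \<in> carrier Q" "w \<in> carrier Q"
    "x' \<in> carrier Q" "y' \<in> carrier Q" "z' \<in> carrier Q" "w' \<in> carrier Q"
    using congruence_carrier[OF cong(1)] xy(1,2) zw(1,2) by auto
  note sub = subgroup_Dis_cong[OF cong(1)]
  have DE_Dis: "D \<in> Dis_cong Q \<alpha>" "E \<in> Dis_cong Q \<alpha>"
    using xy(1) zw(1) by (auto simp: D_def E_def intro: displacement_in_Dis_cong congruence_sym[OF cong(1)])
  have DE: "D \<in> carrier Perm" "E \<in> carrier Perm"
    using DE_Dis subgroup.mem_carrier[OF sub] by auto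
  have Ly: "L y = D \<otimes>\<^bsub>Perm\<^esub> L x" "L y' = D \<otimes>\<^bsub>Perm\<^esub> L x'"
    and Lw: "L w = E \<otimes>\<^bsub>Perm\<^esub> L z" "L w' = E \<otimes>\<^bsub>Perm\<^esub> L z'"
    using car xy(4) zw(4) L_eq_displacement_mult[of y x] L_eq_displacement_mult[of y' x']
      L_eq_displacement_mult[of w z] L_eq_displacement_mult[of w' z']
    by (simp_all only: D_def E_def)
  have move: "L p \<otimes>\<^bsub>Perm\<^esub> k \<otimes>\<^bsub>Perm\<^esub> inv\<^bsub>Perm\<^esub> L p = L q \<otimes>\<^bsub>Perm\<^esub> k \<otimes>\<^bsub>Perm\<^esub> inv\<^bsub>Perm\<^esub> L q"
    if "(p, q) \<in> \<beta>" "k \<in> Dis_cong Q \<alpha>" for p q k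
    using that comm congruence_carrier[OF cong(2)] subgroup.mem_carrier[OF sub]
    by (intro Perm.conjugate_eqI) (auto simp: L_closed inverse_displacement_in_Dis_cong[OF cong(2)])
  have move_inv: "inv\<^bsub>Perm\<^esub> L p \<otimes>\<^bsub>Perm\<^esub> k \<otimes>\<^bsub>Perm\<^esub> L p = inv\<^bsub>Perm\<^esub> L q \<otimes>\<^bsub>Perm\<^esub> k \<otimes>\<^bsub>Perm\<^esub> L q"
    if "(p, q) \<in> \<beta>" "k \<in> Dis_cong Q \<alpha>" for p q k
    using that comm congruence_carrier[OF cong(2)] subgroup.mem_carrier[OF sub]
      Perm.conjugate_eqI[of "inv\<^bsub>Perm\<^esub> L p" "inv\<^bsub>Perm\<^esub> L q" k]
    by (auto simp: L_closed displacement_in_Dis_cong)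
  have xz: "(x \<star> z, x' \<star> z') \<in> \<beta>"
    using cong(2) xy(3) zw(3) by (intro congruence_compat)
  have op: "displacement (y \<star> w) (x \<star> z) =
      D \<otimes>\<^bsub>Perm\<^esub> (L x \<otimes>\<^bsub>Perm\<^esub> E \<otimes>\<^bsub>Perm\<^esub> inv\<^bsub>Perm\<^esub> L x) \<otimes>\<^bsub>Perm\<^esub>
        (L (x \<star> z) \<otimes>\<^bsub>Perm\<^esub> inv\<^bsub>Perm\<^esub> D \<otimes>\<^bsub>Perm\<^esub> inv\<^bsub>Perm\<^esub> L (x \<star> z))"
    using Perm.displacement_of_conjugate(1)[of "L x" "L z" D E] car DE
    by (simp add: L_qop L_closed Ly Lw)
  have op': "displacement (y' \<star> w') (x' \<star> z') =
      D \<otimes>\<^bsub>Perm\<^esub> (L x' \<otimes>\<^bsub>Perm\<^esub> E \<otimes>\<^bsub>Perm\<^esub> inv\<^bsub>Perm\<^esub> L x') \<otimes>\<^bsub>Perm\<^esub>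
        (L (x' \<star> z') \<otimes>\<^bsub>Perm\<^esub> inv\<^bsub>Perm\<^esub> D \<otimes>\<^bsub>Perm\<^esub> inv\<^bsub>Perm\<^esub> L (x' \<star> z'))"
    using Perm.displacement_of_conjugate(1)[of "L x'" "L z'" D E] car DE
    by (simp add: L_qop L_closed Ly Lw)
  show "displacement (y \<star> w) (x \<star> z) = displacement (y' \<star> w') (x' \<star> z')"
    unfolding op op' move[OF xy(3) DE_Dis(2)] move[OF xz subgroup.m_inv_closed[OF sub DE_Dis(1)]] ..
  \<comment> \<open>\<open>K\<close> is the element whose conjugates by \<open>L\<^sub>x\<inverse>\<close> and \<open>L\<^bsub>x'\<^esub>\<inverse>\<close> are the two displacements.\<close>
  define K where "K = inv\<^bsub>Perm\<^esub> D \<otimes>\<^bsub>Perm\<^esub> E \<otimes>\<^bsub>Perm\<^esub> (L z \<otimes>\<^bsub>Perm\<^esub> D \<otimes>\<^bsub>Perm\<^esub> inv\<^bsub>Perm\<^esub> L z)"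
  have "L z \<otimes>\<^bsub>Perm\<^esub> D \<otimes>\<^bsub>Perm\<^esub> inv\<^bsub>Perm\<^esub> L z = displacement (z \<star> y) (z \<star> x)"
    unfolding D_def using car by (intro conjugate_displacement)
  moreover have "(z \<star> y, z \<star> x) \<in> \<alpha>"
    using cong(1) xy(1) car by (auto intro: congruence_compat congruence_refl congruence_sym)
  ultimately have "L z \<otimes>\<^bsub>Perm\<^esub> D \<otimes>\<^bsub>Perm\<^esub> inv\<^bsub>Perm\<^esub> L z \<in> Dis_cong Q \<alpha>"
    by (metis displacement_in_Dis_cong)
  then have K: "K \<in> Dis_cong Q \<alpha>"
    unfolding K_def
    by (rule subgroup.m_closed[OF sub subgroup.m_closed[OF sub
      subgroup.m_inv_closed[OF sub DE_Dis(1)] DE_Dis(2)]])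
  have ld: "displacement (y \<setminus> w) (x \<setminus> z) = inv\<^bsub>Perm\<^esub> L x \<otimes>\<^bsub>Perm\<^esub> K \<otimes>\<^bsub>Perm\<^esub> L x"
    using Perm.displacement_of_conjugate(2)[of "L x" "L z" D E] car DE
    by (simp add: L_ldiv L_closed Ly Lw K_def)
  have ld': "displacement (y' \<setminus> w') (x' \<setminus> z') = inv\<^bsub>Perm\<^esub> L x' \<otimes>\<^bsub>Perm\<^esub> K \<otimes>\<^bsub>Perm\<^esub> L x'"
    using Perm.displacement_of_conjugate(2)[of "L x'" "L z'" D E] car DE
    by (simp add: L_ldiv L_closed Ly Lw K_def move[OF zw(3) DE_Dis(1)])
  show "displacement (y \<setminus> w) (x \<setminus> z) = displacement (y' \<setminus> w') (x' \<setminus> z')"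
    unfolding ld ld' by (rule move_inv[OF xy(3) K])
qed

lemma displacement_eval_term:
  assumes cong: "congruence Q \<alpha>" "congruence Q \<beta>"
    and comm: "\<forall>g \<in> Dis_cong Q \<alpha>. \<forall>h \<in> Dis_cong Q \<beta>. g \<otimes>\<^bsub>Perm\<^esub> h = h \<otimes>\<^bsub>Perm\<^esub> g"
    and ab: "(a, b) \<in> \<alpha>"
    and uv: "\<And>i. \<lbrakk>i \<in> term_vars t; i \<noteq> 0\<rbrakk> \<Longrightarrow> (u i, v i) \<in> \<beta>"
  shows "displacement (eval_term Q (u(0 := b)) t) (eval_term Q (u(0 := a)) t) =
    displacement (eval_term Q (v(0 := b)) t) (eval_term Q (v(0 := a)) t)"
proof -
  have rel: "(eval_term Q (u(0 := a)) r, eval_term Q (u(0 := b)) r) \<in> \<alpha>"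
      "(eval_term Q (v(0 := a)) r, eval_term Q (v(0 := b)) r) \<in> \<alpha>"
      "(eval_term Q (u(0 := a)) r, eval_term Q (v(0 := a)) r) \<in> \<beta>"
    if "\<And>i. \<lbrakk>i \<in> term_vars r; i \<noteq> 0\<rbrakk> \<Longrightarrow> (u i, v i) \<in> \<beta>" for r
    using that ab congruence_carrier[OF cong(1) ab] congruence_carrier[OF cong(2) that]
    by (auto intro!: eval_term_congruent cong congruence_refl)
  show ?thesis
    using uv
  proof (induction t)
    case (Var i)
    then show ?case
      using congruence_carrier[OF cong(2)] by (cases "i = 0") (auto simp: L_closed)
  next
    case (Op s t)
    show ?case
      unfolding eval_term.simps
      by (intro displacement_square(1)[OF cong comm] rel Op.IH Op.prems) auto
  next
    case (Ldiv s t)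
    show ?case
      unfolding eval_term.simps
      by (intro displacement_square(2)[OF cong comm] rel Ldiv.IH Ldiv.prems) auto
  qed
qed

end

section \<open>Centrality in faithful quandles\<close>

context faithful_quandle
begin

text \<open>Faithfulness is what lets the equality of the translations by \<open>t(b, u)\<close> and \<open>t(b, v)\<close> be read as
  equality of the values.\<close>

lemma centralizes_iff_Dis_cong_commute:
  assumes cong: "congruence Q \<alpha>" "congruence Q \<beta>"
  shows "centralizes Q \<alpha> \<beta> (Id_on (carrier Q)) \<longleftrightarrow>
    (\<forall>g \<in> Dis_cong Q \<alpha>. \<forall>h \<in> Dis_cong Q \<beta>. g \<otimes>\<^bsub>Perm\<^esub> h = h \<otimes>\<^bsub>Perm\<^esub> g)" (is "?C \<longleftrightarrow> ?comm")
proof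
  show ?comm if ?C
    unfolding Dis_cong_commute_iff[OF cong]
    using centralizes_imp_displacements_commute[OF cong that] by blast
next
  assume comm: ?comm
  show ?C
    unfolding centralizes_def
  proof (intro allI impI)
    fix n t a b u v
    assume vars: "term_vars t \<subseteq> {..n}" and ab: "(a, b) \<in> \<alpha>"
      and uv: "\<forall>i \<in> {1..n}. (u i, v i) \<in> \<beta>"
      and eq: "(eval_term Q (u(0 := a)) t, eval_term Q (v(0 := a)) t) \<in> Id_on (carrier Q)"
    let ?ua = "eval_term Q (u(0 := a)) t" and ?va = "eval_term Q (v(0 := a)) t"
    let ?ub = "eval_term Q (u(0 := b)) t" and ?vb = "eval_term Q (v(0 := b)) t"
    have uv': "(u i, v i) \<in> \<beta>" if "i \<in> term_vars t" "i \<noteq> 0" for i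
      using that vars uv by auto
    have "(?ua, ?ub) \<in> \<alpha>" "(?va, ?vb) \<in> \<alpha>"
      using ab congruence_carrier[OF cong(2) uv']
      by (auto intro!: eval_term_congruent cong congruence_refl)
    then have car: "?ua \<in> carrier Q" "?ub \<in> carrier Q" "?va \<in> carrier Q" "?vb \<in> carrier Q"
      using congruence_carrier[OF cong(1)] by auto
    have "displacement ?ub ?ua = displacement ?vb ?va"
      using uv' by (intro displacement_eval_term[OF cong comm ab])
    moreover have "?ua = ?va"
      using eq by auto
    ultimately have "L ?ub = L ?vb"
      using car by (simp add: L_closed)
    with car(2,4) have "?ub = ?vb"
      by (rule faithful)
    then show "(?ub, ?vb) \<in> Id_on (carrier Q)"
      using car(4) by auto
  qed
qed

end

theorem corollary5p4:
  fixes Q :: "('a, 'b) left_quasigroup_scheme" and \<alpha> :: "('a \<times> 'a) set"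
  assumes "faithful_quandle Q" and "congruence Q \<alpha>"
  shows "(abelian_cong Q \<alpha> \<longleftrightarrow>
            comm_group ((BijGroup (carrier Q))\<lparr>carrier := Dis_cong Q \<alpha>\<rparr>)) \<and>
         (central_cong Q \<alpha> \<longleftrightarrow>
            Dis_cong Q \<alpha> \<subseteq> group_center ((BijGroup (carrier Q))\<lparr>carrier := Dis Q\<rparr>))"
proof
  interpret faithful_quandle Q by (rule assms(1))
  have total: "congruence Q (carrier Q \<times> carrier Q)"
    by (rule congruence_total) unfold_locales
  have "group (Perm\<lparr>carrier := Dis_cong Q \<alpha>\<rparr>)"
    using subgroup_Dis_cong[OF assms(2)] by (rule Perm.subgroup_imp_group)
  then have "comm_group (Perm\<lparr>carrier := Dis_cong Q \<alpha>\<rparr>) \<longleftrightarrow>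
      (\<forall>g \<in> Dis_cong Q \<alpha>. \<forall>h \<in> Dis_cong Q \<alpha>. g \<otimes>\<^bsub>Perm\<^esub> h = h \<otimes>\<^bsub>Perm\<^esub> g)"
    by (auto intro: group.group_comm_groupI 
        dest: comm_group.axioms(1) comm_monoid.m_comm[where G = "Perm\<lparr>carrier := Dis_cong Q \<alpha>\<rparr>", simplified])
  then show "abelian_cong Q \<alpha> \<longleftrightarrow> comm_group (Perm\<lparr>carrier := Dis_cong Q \<alpha>\<rparr>)"
    unfolding abelian_cong_def centralizes_iff_Dis_cong_commute[OF assms(2) assms(2)] by simp
  have "\<alpha> \<subseteq> carrier Q \<times> carrier Q"
    using congruence_carrier[OF assms(2)] by auto
  then have "Dis_cong Q \<alpha> \<subseteq> Dis Q"
    unfolding Dis_def Dis_cong_def by (intro Perm.mono_generate) auto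
  then show "central_cong Q \<alpha> \<longleftrightarrow> Dis_cong Q \<alpha> \<subseteq> group_center (Perm\<lparr>carrier := Dis Q\<rparr>)"
    unfolding central_cong_def centralizes_iff_Dis_cong_commute[OF assms(2) total]
    by (auto simp: group_center_def Dis_def)
qed

end
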